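(* Let $(A,\exists,\forall)$ be a monadic distributive commutative pseudo BE-algebra and let $D\in\mathcal{MDS}(A,\exists,\forall)$ be a monadic deductive system. Then $(A/D,\exists_D,\forall_D)$ is a monadic BE-algebra, where $\exists_D(x/D)=(\exists x)/D$ and $\forall_D(x/D)=(\forall x)/D$ for all $x\in A$.
   Context: A pseudo BE-algebra is an algebra $(A,\to,\rightsquigarrow,1)$ of type $(2,2,0)$ such that for all $x,y,z\in A$: $x\to x=x\rightsquigarrow x=1$; $x\to 1=x\rightsquigarrow 1=1$; $1\to x=1\rightsquigarrow x=x$; $x\to(y\rightsquigarrow z)=y\rightsquigarrow(x\to z)$; and $x\to y=1$ iff $x\rightsquigarrow y=1$. A BE-algebra is a pseudo BE-algebra in which $\to$ and $\rightsquigarrow$ coincide. A pseudo BE-algebra is commutative if $(x\to y)\rightsquigarrow y=(y\to x)\rightsquigarrow x$ and $(x\rightsquigarrow y)\to y=(y\rightsquigarrow x)\to x$ for all $x,y$. It is distributive if $x\to(y\rightsquigarrow z)=(x\to y)\rightsquigarrow(x\to z)$ for all $x,y,z$. A monadic pseudo BE-algebra is a pseudo BE-algebra $A$ with maps $\exists,\forall:A\to A$ such that for all $x,y\in A$: (M1) $x\to\exists x=x\rightsquigarrow\exists x=1$; (M2) $\forall x\to x=\forall x\rightsquigarrow x=1$; (M3) $\forall(x\to\exists y)=\exists x\to\exists y$ and $\forall(x\rightsquigarrow\exists y)=\exists x\rightsquigarrow\exists y$; (M4) $\forall(\exists x\to y)=\exists x\to\forall y$ and $\forall(\exists x\rightsquigarrow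 y)=\exists x\rightsquigarrow\forall y$; (M5) $\exists\forall x=\forall x$. It is a monadic BE-algebra if its underlying algebra is a BE-algebra, and distributive commutative if its underlying pseudo BE-algebra is distributive and commutative. A deductive system of $A$ is a subset $D$ with $1\in D$ such that $x\in D$ and $x\to y\in D$ imply $y\in D$. It is monadic if $x\in D$ implies $\forall x\in D$; $\mathcal{MDS}(A,\exists,\forall)$ is the set of monadic deductive systems. For a deductive system $D$ of a distributive pseudo BE-algebra, the relation $\Theta_D=\{(x,y): x\to y\in D\text{ and }y\to x\in D\}$ is a congruence (an equivalence relation compatible with $\to$ and $\rightsquigarrow$); $x/D$ denotes the class of $x$, and $A/D$ is the quotient algebra with the induced operations and unit $1/D=D$. *)

theory Defs
  imports Main
begin

locale pseudo_BE_algebra =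
  fixes A :: "'a set"
    and imp :: "'a \<Rightarrow> 'a \<Rightarrow> 'a"  (infixr "\<rightarrow>" 60)
    and pimp :: "'a \<Rightarrow> 'a \<Rightarrow> 'a"  (infixr "\<leadsto>" 60)
    and one :: 'a  ("\<one>")
  assumes imp_closed: "\<lbrakk>x \<in> A; y \<in> A\<rbrakk> \<Longrightarrow> x \<rightarrow> y \<in> A"
    and pimp_closed: "\<lbrakk>x \<in> A; y \<in> A\<rbrakk> \<Longrightarrow> x \<leadsto> y \<in> A"
    and one_closed: "\<one> \<in> A"
    and imp_refl: "x \<in> A \<Longrightarrow> x \<rightarrow> x = \<one>"
    and pimp_refl: "x \<in> A \<Longrightarrow> x \<leadsto> x = \<one>"
    and imp_one: "x \<in> A \<Longrightarrow> x \<rightarrow> \<one> = \<one>"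
    and pimp_one: "x \<in> A \<Longrightarrow> x \<leadsto> \<one> = \<one>"
    and one_imp: "x \<in> A \<Longrightarrow> \<one> \<rightarrow> x = x"
    and one_pimp: "x \<in> A \<Longrightarrow> \<one> \<leadsto> x = x"
    and exchange: "\<lbrakk>x \<in> A; y \<in> A; z \<in> A\<rbrakk> \<Longrightarrow> x \<rightarrow> (y \<leadsto> z) = y \<leadsto> (x \<rightarrow> z)"
    and imp_eq_one_iff: "\<lbrakk>x \<in> A; y \<in> A\<rbrakk> \<Longrightarrow> x \<rightarrow> y = \<one> \<longleftrightarrow> x \<leadsto> y = \<one>"

locale BE_algebra = pseudo_BE_algebra +
  assumes imp_eq_pimp: "\<lbrakk>x \<in> A; y \<in> A\<rbrakk> \<Longrightarrow> x \<rightarrow> y = x \<leadsto> y"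

locale commutative_pseudo_BE_algebra = pseudo_BE_algebra +
  assumes commut_imp: "\<lbrakk>x \<in> A; y \<in> A\<rbrakk> \<Longrightarrow> (x \<rightarrow> y) \<leadsto> y = (y \<rightarrow> x) \<leadsto> x"
    and commut_pimp: "\<lbrakk>x \<in> A; y \<in> A\<rbrakk> \<Longrightarrow> (x \<leadsto> y) \<rightarrow> y = (y \<leadsto> x) \<rightarrow> x"

locale distributive_pseudo_BE_algebra = pseudo_BE_algebra +
  assumes distrib: "\<lbrakk>x \<in> A; y \<in> A; z \<in> A\<rbrakk> \<Longrightarrow> x \<rightarrow> (y \<leadsto> z) = (x \<rightarrow> y) \<leadsto> (x \<rightarrow> z)"

locale monadic_pseudo_BE_algebra = pseudo_BE_algebra +
  fixes ex :: "'a \<Rightarrow> 'a"  ("\<^bold>\<exists>")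
    and all :: "'a \<Rightarrow> 'a"  ("\<^bold>\<forall>")
  assumes ex_closed: "x \<in> A \<Longrightarrow> \<^bold>\<exists> x \<in> A"
    and all_closed: "x \<in> A \<Longrightarrow> \<^bold>\<forall> x \<in> A"
    and M1: "x \<in> A \<Longrightarrow> x \<rightarrow> \<^bold>\<exists> x = \<one>"  "x \<in> A \<Longrightarrow> x \<leadsto> \<^bold>\<exists> x = \<one>"
    and M2: "x \<in> A \<Longrightarrow> \<^bold>\<forall> x \<rightarrow> x = \<one>"  "x \<in> A \<Longrightarrow> \<^bold>\<forall> x \<leadsto> x = \<one>"
    and M3: "\<lbrakk>x \<in> A; y \<in> A\<rbrakk> \<Longrightarrow> \<^bold>\<forall> (x \<rightarrow> \<^bold>\<exists> y) = \<^bold>\<exists> x \<rightarrow> \<^bold>\<exists> y"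
            "\<lbrakk>x \<in> A; y \<in> A\<rbrakk> \<Longrightarrow> \<^bold>\<forall> (x \<leadsto> \<^bold>\<exists> y) = \<^bold>\<exists> x \<leadsto> \<^bold>\<exists> y"
    and M4: "\<lbrakk>x \<in> A; y \<in> A\<rbrakk> \<Longrightarrow> \<^bold>\<forall> (\<^bold>\<exists> x \<rightarrow> y) = \<^bold>\<exists> x \<rightarrow> \<^bold>\<forall> y"
            "\<lbrakk>x \<in> A; y \<in> A\<rbrakk> \<Longrightarrow> \<^bold>\<forall> (\<^bold>\<exists> x \<leadsto> y) = \<^bold>\<exists> x \<leadsto> \<^bold>\<forall> y"
    and M5: "x \<in> A \<Longrightarrow> \<^bold>\<exists> (\<^bold>\<forall> x) = \<^bold>\<forall> x"

locale monadic_BE_algebra = monadic_pseudo_BE_algebra + BE_algebra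

locale monadic_distributive_commutative_pseudo_BE_algebra =
  monadic_pseudo_BE_algebra + distributive_pseudo_BE_algebra + commutative_pseudo_BE_algebra

definition deductive_system :: "'a set \<Rightarrow> ('a \<Rightarrow> 'a \<Rightarrow> 'a) \<Rightarrow> 'a \<Rightarrow> 'a set \<Rightarrow> bool" where
  "deductive_system A imp one D \<longleftrightarrow>
     D \<subseteq> A \<and> one \<in> D \<and> (\<forall>x\<in>A. \<forall>y\<in>A. x \<in> D \<and> imp x y \<in> D \<longrightarrow> y \<in> D)"

definition MDS :: "'a set \<Rightarrow> ('a \<Rightarrow> 'a \<Rightarrow> 'a) \<Rightarrow> 'a \<Rightarrow> ('a \<Rightarrow> 'a) \<Rightarrow> 'a set set" where
  "MDS A imp one all = {D. deductive_system A imp one D \<and> (\<forall>x\<in>D. all x \<in> D)}"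

definition Theta :: "'a set \<Rightarrow> ('a \<Rightarrow> 'a \<Rightarrow> 'a) \<Rightarrow> 'a set \<Rightarrow> 'a rel" where
  "Theta A imp D = {(x, y). x \<in> A \<and> y \<in> A \<and> imp x y \<in> D \<and> imp y x \<in> D}"

text \<open>
  Operations induced on the classes of an equivalence relation \<open>r\<close>, in the style of \<^theory>\<open>HOL.Equiv_Relations\<close>.
  The value at a class is the union of the classes of all results obtained from representatives;
  it is a single class exactly when it does not depend on the representatives.
\<close>

definition quot_op1 :: "'a rel \<Rightarrow> ('a \<Rightarrow> 'a) \<Rightarrow> 'a set \<Rightarrow> 'a set" where
  "quot_op1 r f X = (\<Union>x\<in>X. r `` {f x})"

definition quot_op2 :: "'a rel \<Rightarrow> ('a \<Rightarrow> 'a \<Rightarrow> 'a) \<Rightarrow> 'a set \<Rightarrow> 'a set \<Rightarrow> 'a set" where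
  "quot_op2 r f X Y = (\<Union>x\<in>X. \<Union>y\<in>Y. r `` {f x y})"

text \<open>\<open>Theta A imp D\<close> is a congruence, so the induced implications are well defined.\<close>

context distributive_pseudo_BE_algebra
begin

lemma weaken: "\<lbrakk>x \<in> A; u \<in> A\<rbrakk> \<Longrightarrow> u \<rightarrow> (x \<rightarrow> u) = \<one>" "\<lbrakk>x \<in> A; u \<in> A\<rbrakk> \<Longrightarrow> u \<rightarrow> (x \<leadsto> u) = \<one>"
  using imp_closed pimp_closed exchange imp_eq_one_iff imp_refl pimp_refl imp_one pimp_one
  by metis+

lemma trans_one:
  assumes "x \<in> A" "y \<in> A" "z \<in> A" "x \<rightarrow> y = \<one>" "y \<rightarrow> z = \<one>"
  shows "x \<rightarrow> z = \<one>"
  using assms distrib[of x y z] imp_eq_one_iff[of y z] imp_one[of x] one_pimp[of "x \<rightarrow> z"] imp_closed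
  by simp

lemma imp_imp_pimp: "\<lbrakk>x \<in> A; z \<in> A\<rbrakk> \<Longrightarrow> x \<rightarrow> (x \<leadsto> z) = x \<rightarrow> z"
  using distrib[of x x z] by (simp add: imp_refl one_pimp imp_closed)

lemma pimp_le_imp: "\<lbrakk>x \<in> A; z \<in> A\<rbrakk> \<Longrightarrow> (x \<leadsto> z) \<rightarrow> (x \<rightarrow> z) = \<one>"
  by (metis imp_imp_pimp weaken(1) pimp_closed)

lemma imp_le_pimp:
  assumes "x \<in> A" "z \<in> A"
  shows "(x \<rightarrow> z) \<rightarrow> (x \<leadsto> z) = \<one>"
proof -
  let ?v = "x \<rightarrow> z"
  have v: "?v \<in> A" using assms imp_closed by blast
  have "x \<rightarrow> (?v \<leadsto> z) = \<one>" using exchange[of x ?v z] assms v by (simp add: pimp_refl)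
  with pimp_le_imp[of ?v z] have "x \<rightarrow> (?v \<rightarrow> z) = \<one>"
    using trans_one[of x "?v \<leadsto> z" "?v \<rightarrow> z"] assms v by (simp add: imp_closed pimp_closed)
  then have "x \<leadsto> (?v \<rightarrow> z) = \<one>" using imp_eq_one_iff[of x "?v \<rightarrow> z"] assms v imp_closed by blast
  then show ?thesis using exchange[of ?v x z] assms v by simp
qed

context
  fixes D assumes D: "deductive_system A (\<rightarrow>) \<one> D"
begin

lemma D_up: "\<lbrakk>x \<in> D; y \<in> A; x \<rightarrow> y = \<one>\<rbrakk> \<Longrightarrow> y \<in> D"
  and D_mp: "\<lbrakk>x \<in> D; y \<in> A; x \<rightarrow> y \<in> D\<rbrakk> \<Longrightarrow> y \<in> D"
  and D_sub: "x \<in> D \<Longrightarrow> x \<in> A"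
  and D_one: "\<one> \<in> D"
  using D unfolding deductive_system_def by auto

lemma D_iff: "\<lbrakk>x \<in> A; y \<in> A\<rbrakk> \<Longrightarrow> x \<leadsto> y \<in> D \<longleftrightarrow> x \<rightarrow> y \<in> D"
  by (meson D_up imp_le_pimp pimp_le_imp imp_closed pimp_closed)

lemma D_right:
  assumes "x \<in> A" "y \<in> A" "z \<in> A" "y \<rightarrow> z \<in> D"
  shows "(x \<rightarrow> y) \<rightarrow> (x \<rightarrow> z) \<in> D"
proof -
  have "x \<rightarrow> (y \<leadsto> z) \<in> D"
    using assms D_iff D_up weaken(1) imp_closed pimp_closed by meson
  then show ?thesis using distrib[of x y z] assms D_iff[of "x \<rightarrow> y" "x \<rightarrow> z"] imp_closed by simp
qed

lemma D_trans: "\<lbrakk>x \<in> A; y \<in> A; z \<in> A; x \<rightarrow> y \<in> D; y \<rightarrow> z \<in> D\<rbrakk> \<Longrightarrow> x \<rightarrow> z \<in> D"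
  using D_right D_mp imp_closed by meson

lemma D_left:
  assumes "x \<in> A" "y \<in> A" "z \<in> A" "x \<rightarrow> y \<in> D"
  shows "(y \<rightarrow> z) \<rightarrow> (x \<rightarrow> z) \<in> D"
proof -
  let ?v = "y \<rightarrow> z"
  have v: "?v \<in> A" using assms imp_closed by blast
  have "y \<rightarrow> (?v \<leadsto> z) = \<one>" using exchange[of y ?v z] assms v by (simp add: pimp_refl)
  then have "x \<rightarrow> (?v \<leadsto> z) \<in> D"
    using D_trans[of x y "?v \<leadsto> z"] assms v D_one by (simp add: pimp_closed)
  then have "?v \<leadsto> (x \<rightarrow> z) \<in> D" using exchange[of x ?v z] assms v by simp
  then show ?thesis using D_iff assms v imp_closed by blast
qed

lemma equiv_Theta: "equiv A (Theta A (\<rightarrow>) D)"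
proof (rule equivI)
  show "refl_on A (Theta A (\<rightarrow>) D)"
    by (auto simp: refl_on_def Theta_def imp_refl D_one)
  show "sym (Theta A (\<rightarrow>) D)" by (auto simp: sym_def Theta_def)
  show "trans (Theta A (\<rightarrow>) D)" unfolding trans_def Theta_def using D_trans by blast
  show "Theta A (\<rightarrow>) D \<subseteq> A \<times> A" by (auto simp: Theta_def)
qed

lemma Theta_imp:
  assumes "(x, x') \<in> Theta A (\<rightarrow>) D" "(y, y') \<in> Theta A (\<rightarrow>) D"
  shows "(x \<rightarrow> y, x' \<rightarrow> y') \<in> Theta A (\<rightarrow>) D"
proof -
  have "(x \<rightarrow> y, x \<rightarrow> y') \<in> Theta A (\<rightarrow>) D"
    using assms D_right imp_closed unfolding Theta_def by auto
  moreover have "(x \<rightarrow> y', x' \<rightarrow> y') \<in> Theta A (\<rightarrow>) D"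
    using assms D_left imp_closed unfolding Theta_def by auto
  ultimately show ?thesis using equiv_Theta by (meson equivE transE)
qed

lemma Theta_imp_pimp: "\<lbrakk>x \<in> A; y \<in> A\<rbrakk> \<Longrightarrow> (x \<rightarrow> y, x \<leadsto> y) \<in> Theta A (\<rightarrow>) D"
  using imp_le_pimp pimp_le_imp D_one imp_closed pimp_closed unfolding Theta_def by auto

lemma Theta_pimp:
  assumes "(x, x') \<in> Theta A (\<rightarrow>) D" "(y, y') \<in> Theta A (\<rightarrow>) D"
  shows "(x \<leadsto> y, x' \<leadsto> y') \<in> Theta A (\<rightarrow>) D"
proof -
  have "x \<in> A" "y \<in> A" "x' \<in> A" "y' \<in> A" using assms by (auto simp: Theta_def)
  then show ?thesis
    using Theta_imp[OF assms] Theta_imp_pimp equiv_Theta by (meson equivE transE symE)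
qed

lemma congruent2_Theta:
  "(\<lambda>x y. Theta A (\<rightarrow>) D `` {x \<rightarrow> y}) respects2 Theta A (\<rightarrow>) D"
  "(\<lambda>x y. Theta A (\<rightarrow>) D `` {x \<leadsto> y}) respects2 Theta A (\<rightarrow>) D"
  using Theta_imp Theta_pimp equiv_Theta
  by (auto simp: congruent2_def intro!: equiv_class_eq)

lemma quot_op2_Theta:
  assumes "x \<in> A" "y \<in> A"
  shows "quot_op2 (Theta A (\<rightarrow>) D) (\<rightarrow>) (Theta A (\<rightarrow>) D `` {x}) (Theta A (\<rightarrow>) D `` {y})
           = Theta A (\<rightarrow>) D `` {x \<rightarrow> y}"
    and "quot_op2 (Theta A (\<rightarrow>) D) (\<leadsto>) (Theta A (\<rightarrow>) D `` {x}) (Theta A (\<rightarrow>) D `` {y})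
           = Theta A (\<rightarrow>) D `` {x \<leadsto> y}"
  unfolding quot_op2_def
  using UN_equiv_class2[OF equiv_Theta equiv_Theta congruent2_Theta(1) assms]
    UN_equiv_class2[OF equiv_Theta equiv_Theta congruent2_Theta(2) assms] by auto

lemma Theta_class_one: "Theta A (\<rightarrow>) D `` {\<one>} = D"
  using D_sub D_one by (auto simp: Theta_def one_imp imp_one one_closed)

end

end

end

theory Submission
  imports Defs
begin

text \<open>
  Write \<open>\<Theta>\<close> for the congruence of \<open>D\<close>. All equational axioms pass from \<open>A\<close> to the classes once the
  operations are known to be well defined on them, and \<open>\<rightarrow>\<close> and \<open>\<leadsto>\<close> become equal because
  distributivity puts \<open>x \<rightarrow> y\<close> and \<open>x \<leadsto> y\<close> below each other; this also settles the one axiom that is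
  not an equation, that \<open>x \<rightarrow> y = \<one>\<close> holds exactly when \<open>x \<leadsto> y = \<one>\<close>.

  What remains is that the quantifiers respect \<open>\<Theta>\<close>. The system \<open>D\<close> is closed under \<open>\<^bold>\<forall>\<close>, so it
  suffices to see that \<open>\<^bold>\<forall>x \<rightarrow> \<^bold>\<forall>y\<close> and \<open>\<^bold>\<exists>x \<rightarrow> \<^bold>\<exists>y\<close> are universally quantified elements of \<open>D\<close>
  whenever \<open>x \<rightarrow> y \<in> D\<close>. Indeed they are \<open>\<^bold>\<forall>(\<^bold>\<forall>x \<rightarrow> y)\<close> and \<open>\<^bold>\<forall>(x \<rightarrow> \<^bold>\<exists>y)\<close>, and both
  \<open>\<^bold>\<forall>x \<rightarrow> y\<close> and \<open>x \<rightarrow> \<^bold>\<exists>y\<close> lie above \<open>x \<rightarrow> y\<close>, because \<open>\<^bold>\<forall>x\<close> is below \<open>x\<close> and \<open>y\<close> is below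
  \<open>\<^bold>\<exists>y\<close>.
\<close>

locale monadic_distributive_pseudo_BE_algebra =
  monadic_pseudo_BE_algebra + distributive_pseudo_BE_algebra
begin

context
  fixes D assumes D: "D \<in> MDS A (\<rightarrow>) \<one> \<^bold>\<forall>"
begin

lemma ded: "deductive_system A (\<rightarrow>) \<one> D"
  and D_all: "x \<in> D \<Longrightarrow> \<^bold>\<forall> x \<in> D"
  using D by (auto simp: MDS_def)

text \<open>Since \<open>\<^bold>\<forall>x\<close> is a fixed point of \<open>\<^bold>\<exists>\<close>, axiom (M4) applies with \<open>\<^bold>\<forall>x\<close> as its existential premise.\<close>

lemma all_monotone_mod_D:
  assumes "x \<in> A" "y \<in> A" "x \<rightarrow> y \<in> D"
  shows "\<^bold>\<forall> x \<rightarrow> \<^bold>\<forall> y \<in> D"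
proof -
  have "\<^bold>\<forall> x \<rightarrow> y \<in> D"
    using D_trans[OF ded, of "\<^bold>\<forall> x" x y] assms M2(1) D_one[OF ded] all_closed by simp
  then have "\<^bold>\<forall> (\<^bold>\<exists> (\<^bold>\<forall> x) \<rightarrow> y) \<in> D" using D_all M5 assms by simp
  then show ?thesis using M4(1)[of "\<^bold>\<forall> x" y] M5 all_closed assms by simp
qed

lemma ex_monotone_mod_D:
  assumes "x \<in> A" "y \<in> A" "x \<rightarrow> y \<in> D"
  shows "\<^bold>\<exists> x \<rightarrow> \<^bold>\<exists> y \<in> D"
proof -
  have "x \<rightarrow> \<^bold>\<exists> y \<in> D"
    using D_trans[OF ded, of x y "\<^bold>\<exists> y"] assms M1(1) D_one[OF ded] ex_closed by simp
  then have "\<^bold>\<forall> (x \<rightarrow> \<^bold>\<exists> y) \<in> D" by (rule D_all)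
  then show ?thesis using M3(1) assms by simp
qed

lemma Theta_all: "(x, y) \<in> Theta A (\<rightarrow>) D \<Longrightarrow> (\<^bold>\<forall> x, \<^bold>\<forall> y) \<in> Theta A (\<rightarrow>) D"
  and Theta_ex: "(x, y) \<in> Theta A (\<rightarrow>) D \<Longrightarrow> (\<^bold>\<exists> x, \<^bold>\<exists> y) \<in> Theta A (\<rightarrow>) D"
  using all_monotone_mod_D ex_monotone_mod_D all_closed ex_closed by (auto simp: Theta_def)

lemma quot_op1_Theta:
  assumes "x \<in> A"
  shows "quot_op1 (Theta A (\<rightarrow>) D) \<^bold>\<exists> (Theta A (\<rightarrow>) D `` {x}) = Theta A (\<rightarrow>) D `` {\<^bold>\<exists> x}"
    and "quot_op1 (Theta A (\<rightarrow>) D) \<^bold>\<forall> (Theta A (\<rightarrow>) D `` {x}) = Theta A (\<rightarrow>) D `` {\<^bold>\<forall> x}"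
proof -
  have "(\<lambda>x. Theta A (\<rightarrow>) D `` {\<^bold>\<exists> x}) respects Theta A (\<rightarrow>) D"
    and "(\<lambda>x. Theta A (\<rightarrow>) D `` {\<^bold>\<forall> x}) respects Theta A (\<rightarrow>) D"
    using Theta_ex Theta_all by (auto simp: congruent_def intro!: equiv_class_eq[OF equiv_Theta[OF ded]])
  then show "quot_op1 (Theta A (\<rightarrow>) D) \<^bold>\<exists> (Theta A (\<rightarrow>) D `` {x}) = Theta A (\<rightarrow>) D `` {\<^bold>\<exists> x}"
    and "quot_op1 (Theta A (\<rightarrow>) D) \<^bold>\<forall> (Theta A (\<rightarrow>) D `` {x}) = Theta A (\<rightarrow>) D `` {\<^bold>\<forall> x}"
    unfolding quot_op1_def
    using UN_equiv_class[OF equiv_Theta[OF ded] _ assms] by auto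
qed

lemma quotient_monadic_BE_algebra:
  "monadic_BE_algebra (A // Theta A (\<rightarrow>) D)
     (quot_op2 (Theta A (\<rightarrow>) D) (\<rightarrow>)) (quot_op2 (Theta A (\<rightarrow>) D) (\<leadsto>)) (Theta A (\<rightarrow>) D `` {\<one>})
     (quot_op1 (Theta A (\<rightarrow>) D) \<^bold>\<exists>) (quot_op1 (Theta A (\<rightarrow>) D) \<^bold>\<forall>)"
proof -
  let ?cls = "\<lambda>x. Theta A (\<rightarrow>) D `` {x}"
  have classes: "A // Theta A (\<rightarrow>) D = ?cls ` A" by (auto simp: quotient_def)
  have imp_pimp: "?cls (x \<rightarrow> y) = ?cls (x \<leadsto> y)" if "x \<in> A" "y \<in> A" for x y
    using Theta_imp_pimp[OF ded that] by (rule equiv_class_eq[OF equiv_Theta[OF ded]])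
  note ops = quot_op2_Theta[OF ded] quot_op1_Theta
  note closed = imp_closed pimp_closed one_closed ex_closed all_closed
  show ?thesis
    unfolding classes
    \<comment> \<open>Turning \<open>\<rightarrow>\<close> into \<open>\<leadsto>\<close> would spoil the exchange law, so that rule waits for the two axioms
      which compare the implications.\<close>
    by (unfold_locales; (elim imageE; hypsubst)?;
        (simp add: ops closed imp_refl pimp_refl imp_one pimp_one one_imp one_pimp exchange
          M1 M2 M3 M4 M5; fail)?)
      (simp_all add: ops closed imp_pimp)
qed

end

end

theorem theorem6p12:
  fixes A :: "'a set" and imp pimp :: "'a \<Rightarrow> 'a \<Rightarrow> 'a" and one :: 'a
    and ex all :: "'a \<Rightarrow> 'a" and D :: "'a set"
  assumes "monadic_distributive_commutative_pseudo_BE_algebra A imp pimp one ex all"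
    and "D \<in> MDS A imp one all"
  defines "\<Theta> \<equiv> Theta A imp D"
  shows "monadic_BE_algebra (A // \<Theta>) (quot_op2 \<Theta> imp) (quot_op2 \<Theta> pimp) (\<Theta> `` {one})
           (quot_op1 \<Theta> ex) (quot_op1 \<Theta> all)
         \<and> (\<forall>x\<in>A. quot_op1 \<Theta> ex (\<Theta> `` {x}) = \<Theta> `` {ex x})
         \<and> (\<forall>x\<in>A. quot_op1 \<Theta> all (\<Theta> `` {x}) = \<Theta> `` {all x})"
proof -
  interpret monadic_distributive_commutative_pseudo_BE_algebra A imp pimp one ex all
    by (fact assms(1))
  interpret monadic_distributive_pseudo_BE_algebra A imp pimp one ex all
    by unfold_locales
  show ?thesis
    unfolding \<Theta>_def
    using quotient_monadic_BE_algebra[OF assms(2)] quot_op1_Theta[OF assms(2)] by blast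
qed

end
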